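(* Let $X$ be an infinite dimensional real Banach space. If $X$ contains an isomorphic copy of $c_0$ or of $\ell_1$, then $K_a(X)=2$. If $X$ contains an isomorphic copy of $\ell_p$ for some $1<p<\infty$, then $K_a(X)\ge 2^{1/p}$.
   Context: For a Banach space $X$, $B_X$ denotes its closed unit ball and $X^*$ its dual. "Contains an isomorphic copy of $Y$" means that some closed linear subspace of $X$ is linearly homeomorphic to $Y$. For positive constants $c_1,c_2,d$, a subset $S$ of a normed space $X$ is called a $(c_1,c_2,d)$-b.s.a. (bounded and separated antipodal) subset of $X$ if (1) $\|x\|\le c_1$ for all $x\in S$, and (2) for every $x,y\in S$ with $x\ne y$ there exists $f\in X^*$ with $\|f\|\le c_2$ such that $d\le f(y)-f(x)$ and $f(x)\le f(z)\le f(y)$ for all $z\in S$. For an infinite dimensional Banach space $X$, $$K_a(X)=\sup\{d>0:\ \text{there exists an infinite } S\subseteq B_X \text{ which is a } (1,1,d)\text{-b.s.a. subset of } X\}.$$ *)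

theory Defs
  imports "HOL-Analysis.Analysis"
begin

subsection \<open>The classical sequence spaces\<close>

definition c0_space :: "(nat \<Rightarrow> real) set"
  where "c0_space = {x. x \<longlonglongrightarrow> 0}"

definition c0_norm :: "(nat \<Rightarrow> real) \<Rightarrow> real"
  where "c0_norm x = (SUP n. \<bar>x n\<bar>)"

definition ell_space :: "real \<Rightarrow> (nat \<Rightarrow> real) set"
  where "ell_space p = {x. summable (\<lambda>n. \<bar>x n\<bar> powr p)}"

definition ell_norm :: "real \<Rightarrow> (nat \<Rightarrow> real) \<Rightarrow> real"
  where "ell_norm p x = (\<Sum>n. \<bar>x n\<bar> powr p) powr (1 / p)"

(* The value 0 outside V is only there because the library's Metric_space asks for a
   nonnegative symmetric function on the whole type; it does not influence the topology. *)
definition norm_dist :: "(nat \<Rightarrow> real) set \<Rightarrow> ((nat \<Rightarrow> real) \<Rightarrow> real)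
    \<Rightarrow> (nat \<Rightarrow> real) \<Rightarrow> (nat \<Rightarrow> real) \<Rightarrow> real"
  where "norm_dist V N x y = (if x \<in> V \<and> y \<in> V then N (\<lambda>n. x n - y n) else 0)"

definition norm_topology :: "(nat \<Rightarrow> real) set \<Rightarrow> ((nat \<Rightarrow> real) \<Rightarrow> real) \<Rightarrow> (nat \<Rightarrow> real) topology"
  where "norm_topology V N = Metric_space.mtopology V (norm_dist V N)"

definition linear_on_seqs :: "(nat \<Rightarrow> real) set \<Rightarrow> ((nat \<Rightarrow> real) \<Rightarrow> 'a::real_vector) \<Rightarrow> bool"
  where "linear_on_seqs V T \<longleftrightarrow>
    (\<forall>x\<in>V. \<forall>y\<in>V. T (\<lambda>n. x n + y n) = T x + T y) \<and>
    (\<forall>c. \<forall>x\<in>V. T (\<lambda>n. c * x n) = c *\<^sub>R T x)"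

definition contains_isomorphic_copy ::
    "'a::real_normed_vector itself \<Rightarrow> (nat \<Rightarrow> real) set \<Rightarrow> ((nat \<Rightarrow> real) \<Rightarrow> real) \<Rightarrow> bool"
  where "contains_isomorphic_copy _ V N \<longleftrightarrow>
    (\<exists>(Z :: 'a set) T. subspace Z \<and> closed Z \<and> linear_on_seqs V T \<and>
       homeomorphic_map (norm_topology V N) (top_of_set Z) T)"

subsection \<open>Bounded and separated antipodal sets\<close>

definition infinite_dimensional :: "'a::real_vector itself \<Rightarrow> bool"
  where "infinite_dimensional _ \<longleftrightarrow> \<not> (\<exists>B :: 'a set. finite B \<and> span B = UNIV)"

definition bsa :: "real \<Rightarrow> real \<Rightarrow> real \<Rightarrow> 'a::real_normed_vector set \<Rightarrow> bool"
  where "bsa c1 c2 d S \<longleftrightarrow>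
    (\<forall>x\<in>S. norm x \<le> c1) \<and>
    (\<forall>x\<in>S. \<forall>y\<in>S. x \<noteq> y \<longrightarrow>
      (\<exists>f :: 'a \<Rightarrow>\<^sub>L real. norm f \<le> c2 \<and> d \<le> blinfun_apply f y - blinfun_apply f x \<and>
         (\<forall>z\<in>S. blinfun_apply f x \<le> blinfun_apply f z \<and> blinfun_apply f z \<le> blinfun_apply f y)))"

definition Ka_set :: "'a::real_normed_vector itself \<Rightarrow> real set"
  where "Ka_set _ = {d. d > 0 \<and> (\<exists>S :: 'a set. infinite S \<and> S \<subseteq> cball 0 1 \<and> bsa 1 1 d S)}"

definition Ka :: "'a::real_normed_vector itself \<Rightarrow> real"
  where "Ka X = Sup (Ka_set X)"

subsection \<open>Well-definedness of the notions above\<close>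

lemma Ka_set_le_2:
  assumes "d \<in> Ka_set TYPE('a::real_normed_vector)"
  shows "d \<le> 2"
proof -
  obtain S :: "'a set" where S: "infinite S" "S \<subseteq> cball 0 1" "bsa 1 1 d S"
    using assms by (auto simp: Ka_set_def)
  obtain x where x: "x \<in> S"
    using S(1) by (metis finite.emptyI ex_in_conv)
  obtain y where y: "y \<in> S" "x \<noteq> y"
    using S(1) by (metis finite.emptyI finite_insert insertI1 finite_subset subsetI)
  obtain f :: "'a \<Rightarrow>\<^sub>L real" where f: "norm f \<le> 1" "d \<le> blinfun_apply f y - blinfun_apply f x"
    using S(3) x y unfolding bsa_def by blast
  have *: "\<bar>blinfun_apply f z\<bar> \<le> 1" if "z \<in> S" for z
  proof -
    have "\<bar>blinfun_apply f z\<bar> \<le> norm f * norm z"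
      using norm_blinfun [of f z] by simp
    also have "\<dots> \<le> 1 * 1"
      using f(1) S(2) that by (intro mult_mono) auto
    finally show ?thesis by simp
  qed
  show ?thesis
    using f(2) *[OF x] *[OF y(1)] by linarith
qed

lemma bdd_above_Ka_set: "bdd_above (Ka_set TYPE('a::real_normed_vector))"
  by (meson Ka_set_le_2 bdd_above.I)

lemma Metric_space_norm_dist:
  assumes diff: "\<And>x y. x \<in> V \<Longrightarrow> y \<in> V \<Longrightarrow> (\<lambda>n. x n - y n) \<in> V"
    and nn: "\<And>x. x \<in> V \<Longrightarrow> 0 \<le> N x"
    and zero: "\<And>x. x \<in> V \<Longrightarrow> N x = 0 \<longleftrightarrow> (\<forall>n. x n = 0)"
    and sym: "\<And>x. N (\<lambda>n. - x n) = N x"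
    and tri: "\<And>x y. x \<in> V \<Longrightarrow> y \<in> V \<Longrightarrow> N (\<lambda>n. x n + y n) \<le> N x + N y"
  shows "Metric_space V (norm_dist V N)"
proof
  fix x y show "0 \<le> norm_dist V N x y"
    using diff nn by (simp add: norm_dist_def)
next
  fix x y show "norm_dist V N x y = norm_dist V N y x"
    using sym [of "\<lambda>n. x n - y n"] by (simp add: norm_dist_def)
next
  fix x y assume "x \<in> V" "y \<in> V"
  then show "norm_dist V N x y = 0 \<longleftrightarrow> x = y"
    using zero [OF diff] by (auto simp: norm_dist_def fun_eq_iff)
next
  fix x y z assume "x \<in> V" "y \<in> V" "z \<in> V"
  then show "norm_dist V N x z \<le> norm_dist V N x y + norm_dist V N y z"
    using tri [OF diff diff, of x y y z] by (simp add: norm_dist_def)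
qed

lemma bdd_c0: "x \<in> c0_space \<Longrightarrow> bdd_above (range (\<lambda>n. \<bar>x n\<bar>))"
proof -
  assume "x \<in> c0_space"
  then have "Bseq x"
    by (auto simp: c0_space_def intro: convergent_imp_Bseq convergentI)
  then show ?thesis
    by (metis BseqE bdd_above.I2 real_norm_def)
qed

lemma c0_norm_upper: "x \<in> c0_space \<Longrightarrow> \<bar>x n\<bar> \<le> c0_norm x"
  unfolding c0_norm_def by (rule cSUP_upper) (auto intro: bdd_c0)

lemma Metric_space_c0: "Metric_space c0_space (norm_dist c0_space c0_norm)"
proof (rule Metric_space_norm_dist)
  fix x y assume "x \<in> c0_space" "y \<in> c0_space"
  then show "(\<lambda>n. x n - y n) \<in> c0_space"
    using tendsto_diff [of x 0 sequentially y 0] by (simp add: c0_space_def)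
  show "c0_norm (\<lambda>n. x n + y n) \<le> c0_norm x + c0_norm y"
    unfolding c0_norm_def [of "\<lambda>n. x n + y n"]
  proof (rule cSUP_least)
    fix n
    show "\<bar>x n + y n\<bar> \<le> c0_norm x + c0_norm y"
      using c0_norm_upper [OF \<open>x \<in> c0_space\<close>, of n] c0_norm_upper [OF \<open>y \<in> c0_space\<close>, of n]
      by linarith
  qed simp
next
  fix x assume x: "x \<in> c0_space"
  show "0 \<le> c0_norm x"
    using c0_norm_upper [OF x, of 0] by linarith
  show "c0_norm x = 0 \<longleftrightarrow> (\<forall>n. x n = 0)"
    using c0_norm_upper [OF x] by (auto simp: c0_norm_def)
qed (simp add: c0_norm_def)

lemma powr_convex_nonneg:
  fixes a b t p :: real
  assumes "p \<ge> 1" "a \<ge> 0" "b \<ge> 0" "0 < t" "t < 1"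
  shows "((1 - t) * a + t * b) powr p \<le> (1 - t) * a powr p + t * b powr p"
proof -
  have scale: "(s * c) powr p \<le> s * c powr p" if "0 < s" "s < 1" "c \<ge> 0" for s c :: real
  proof -
    have "s powr p \<le> s powr 1"
      using that assms by (intro powr_mono') auto
    then have "s powr p * c powr p \<le> s * c powr p"
      using that by (intro mult_right_mono) auto
    then show ?thesis
      using that by (simp add: powr_mult)
  qed
  show ?thesis
  proof (cases "a = 0 \<or> b = 0")
    case True
    then show ?thesis
      using scale [of t b] scale [of "1 - t" a] assms by auto
  next
    case False
    then show ?thesis
      using convex_onD [OF powr_convex [OF assms(1)], of t a b] assms by auto
  qed
qed

lemma ell_norm_nonneg: "0 \<le> ell_norm p x"
  by (simp add: ell_norm_def)

lemma ell_norm_powr: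
  assumes "p \<ge> 1" "x \<in> ell_space p"
  shows "ell_norm p x powr p = (\<Sum>n. \<bar>x n\<bar> powr p)"
proof -
  have "0 \<le> (\<Sum>n. \<bar>x n\<bar> powr p)"
    using assms by (intro suminf_nonneg) (auto simp: ell_space_def)
  then show ?thesis
    using assms by (simp add: ell_norm_def powr_powr)
qed

lemma ell_norm_eq_0:
  assumes "p \<ge> 1" "x \<in> ell_space p"
  shows "ell_norm p x = 0 \<longleftrightarrow> (\<forall>n. x n = 0)"
  using assms suminf_eq_zero_iff [of "\<lambda>n. \<bar>x n\<bar> powr p"]
  by (auto simp: ell_norm_def ell_space_def)

text \<open>Minkowski's inequality.\<close>

lemma ell_add:
  assumes p: "p \<ge> 1" and x: "x \<in> ell_space p" and y: "y \<in> ell_space p"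
  shows "(\<lambda>n. x n + y n) \<in> ell_space p"
    and "ell_norm p (\<lambda>n. x n + y n) \<le> ell_norm p x + ell_norm p y"
proof -
  define a b where "a = ell_norm p x" and "b = ell_norm p y"
  have nn: "a \<ge> 0" "b \<ge> 0"
    by (auto simp: a_def b_def ell_norm_nonneg)
  have "(\<lambda>n. x n + y n) \<in> ell_space p \<and> ell_norm p (\<lambda>n. x n + y n) \<le> a + b"
  proof (cases "a = 0 \<or> b = 0")
    case True
    then show ?thesis
      using ell_norm_eq_0 [OF p x] ell_norm_eq_0 [OF p y] x y nn
      by (auto simp: a_def b_def)
  next
    case False
    with nn have ab: "a > 0" "b > 0" by auto
    define t where "t = b / (a + b)"
    have t: "0 < t" "t < 1" "1 - t = a / (a + b)"
      using ab by (auto simp: t_def field_simps)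
    let ?g = "\<lambda>n. (a + b) powr p * ((1 - t) * (\<bar>x n\<bar> powr p / a powr p) + t * (\<bar>y n\<bar> powr p / b powr p))"
    have le: "\<bar>x n + y n\<bar> powr p \<le> ?g n" for n
    proof -
      have "\<bar>x n + y n\<bar> \<le> (a + b) * ((1 - t) * (\<bar>x n\<bar> / a) + t * (\<bar>y n\<bar> / b))"
      proof -
        have "(a + b) * ((1 - t) * (\<bar>x n\<bar> / a)) = \<bar>x n\<bar>"
          using ab by (simp add: t(3))
        moreover have "(a + b) * (t * (\<bar>y n\<bar> / b)) = \<bar>y n\<bar>"
          using ab by (simp add: t_def)
        ultimately show ?thesis
          by (simp add: distrib_left abs_triangle_ineq)
      qed
      then have "\<bar>x n + y n\<bar> powr p
          \<le> ((a + b) * ((1 - t) * (\<bar>x n\<bar> / a) + t * (\<bar>y n\<bar> / b))) powr p"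
        using p by (intro powr_mono2) auto
      also have "\<dots> = (a + b) powr p * ((1 - t) * (\<bar>x n\<bar> / a) + t * (\<bar>y n\<bar> / b)) powr p"
        using ab t by (intro powr_mult)
      also have "\<dots> \<le> (a + b) powr p * ((1 - t) * (\<bar>x n\<bar> / a) powr p + t * (\<bar>y n\<bar> / b) powr p)"
        using ab t p by (intro mult_left_mono powr_convex_nonneg) auto
      also have "\<dots> = ?g n"
        using ab by (simp add: powr_divide)
      finally show ?thesis .
    qed
    have "(\<lambda>n. \<bar>x n\<bar> powr p) sums (a powr p)" "(\<lambda>n. \<bar>y n\<bar> powr p) sums (b powr p)"
      using x y ell_norm_powr [OF p x] ell_norm_powr [OF p y]
      by (auto simp: a_def b_def ell_space_def summable_sums)
    then have "?g sums ((a + b) powr p * ((1 - t) * (a powr p / a powr p) + t * (b powr p / b powr p)))"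
      by (intro sums_mult sums_add sums_divide)
    then have g: "?g sums ((a + b) powr p)"
      using ab by simp
    have sm: "summable (\<lambda>n. \<bar>x n + y n\<bar> powr p)"
      using le by (intro summable_comparison_test' [OF sums_summable [OF g], of 0]) simp
    then have "(\<Sum>n. \<bar>x n + y n\<bar> powr p) \<le> (a + b) powr p"
      using suminf_le [OF le sm sums_summable [OF g]] sums_unique [OF g] by simp
    then have "ell_norm p (\<lambda>n. x n + y n) \<le> ((a + b) powr p) powr (1 / p)"
      unfolding ell_norm_def using p sm
      by (intro powr_mono2) (auto intro: suminf_nonneg)
    then show ?thesis
      using sm p ab by (simp add: ell_space_def powr_powr)
  qed
  then show "(\<lambda>n. x n + y n) \<in> ell_space p"
    and "ell_norm p (\<lambda>n. x n + y n) \<le> ell_norm p x + ell_norm p y"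
    by (auto simp: a_def b_def)
qed

lemma Metric_space_ell:
  assumes "p \<ge> 1"
  shows "Metric_space (ell_space p) (norm_dist (ell_space p) (ell_norm p))"
proof (rule Metric_space_norm_dist)
  fix x y assume xy: "x \<in> ell_space p" "y \<in> ell_space p"
  then have "(\<lambda>n. - y n) \<in> ell_space p"
    by (simp add: ell_space_def)
  then show "(\<lambda>n. x n - y n) \<in> ell_space p"
    using ell_add(1) [OF assms xy(1)] by fastforce
qed (use assms in \<open>auto simp: ell_norm_nonneg ell_norm_eq_0 ell_add, simp add: ell_norm_def\<close>)

end

theory Submission
  imports Defs
begin

text \<open>
  The idea is to find inside the copy of the sequence space a sequence of disjointly supported
  blocks that satisfies a sharp one-sided estimate, and to let Hahn--Banach duality turn this
  estimate into antipodal functionals on all of \<open>X\<close>.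

  Duality (\<open>functional_nonneg_on_cone\<close>): if \<open>C\<close> is a convex cone and every point of \<open>v + C\<close> has
  norm at least \<open>d\<close>, then some \<open>f\<close> of norm at most 1 satisfies \<open>f v \<ge> d\<close> and is nonnegative on \<open>C\<close>.
  To antipodally separate \<open>u i\<close> from \<open>u j\<close>, one takes \<open>v = u j - u i\<close> and a cone large enough
  for nonnegativity to place all other values \<open>f (u k)\<close> between \<open>f (u i)\<close> and \<open>f (u j)\<close>.
  Antipodality thus becomes a lower norm estimate, which needs to be known only in the copy of
  the sequence space; no functional has to be extended.

  Blocks (\<open>almost_proportional_blocks\<close>): this is the argument behind James' distortion theorem.
  Let \<open>T\<close> be the given embedding. On finitely supported sequences the sequence space norm \<open>N x\<close>
  and \<open>norm (T x)\<close> are equivalent. The best constant in \<open>A \<le> \<alpha> B\<close> between two equivalent norms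
  decreases when one restricts to sequences supported further out, so it stabilises up to a
  factor \<open>\<theta> < 1\<close>, and from then on it is almost attained arbitrarily far out, hence on infinitely
  many disjoint blocks.

  For \<open>l_p\<close> with \<open>1 \<le> p\<close>, take \<open>A = N\<close> and \<open>B x = norm (T x)\<close>. The resulting normalised blocks
  \<open>T (y k)\<close> form the antipodal set: a vector whose coefficients at \<open>y j\<close> and \<open>y i\<close> are at least \<open>1\<close>
  and at most \<open>-1\<close> has \<open>l_p\<close> norm at least \<open>2 powr (1 / p)\<close> times the least norm of a block. The
  case \<open>p = 1\<close> gives the value 2.

  For \<open>c_0\<close>, take \<open>A x = norm (T x)\<close> and \<open>B = N\<close>. Reflecting one block converts the sharp upper
  estimate into an almost sharp lower one. The antipodal set consists of the vectors
  \<open>y 0 + ... + y k - y (k + 1)\<close>, suitably scaled: for \<open>i < j\<close> the coefficient at \<open>y (i + 1)\<close> is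
  \<open>-1\<close> in the \<open>i\<close>-th vector, \<open>1\<close> in the \<open>j\<close>-th and between these in all the others.
\<close>
section \<open>Functionals that are nonnegative on a cone\<close>

definition sublinear :: "('a::real_vector \<Rightarrow> real) \<Rightarrow> bool"
  where "sublinear q \<longleftrightarrow>
    (\<forall>x y. q (x + y) \<le> q x + q y) \<and> (\<forall>t>0. \<forall>x. q (t *\<^sub>R x) \<le> t * q x)"

lemma sublinear_add: "sublinear q \<Longrightarrow> q (x + y) \<le> q x + q y"
  by (simp add: sublinear_def)

lemma sublinear_scale_pos:
  assumes "sublinear q" "t > 0"
  shows "q (t *\<^sub>R x) = t * q x"
proof (rule antisym)
  show "q (t *\<^sub>R x) \<le> t * q x"
    using assms by (simp add: sublinear_def)
  have "q ((1 / t) *\<^sub>R (t *\<^sub>R x)) \<le> (1 / t) * q (t *\<^sub>R x)"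
    using assms unfolding sublinear_def by (metis zero_less_divide_1_iff)
  then show "t * q x \<le> q (t *\<^sub>R x)"
    using assms by (simp add: field_simps)
qed

lemma sublinear_zero: "sublinear q \<Longrightarrow> q 0 = 0"
  using sublinear_scale_pos [of q 2 0] by simp

lemma sublinear_scale:
  assumes "sublinear q" "t \<ge> 0"
  shows "q (t *\<^sub>R x) = t * q x"
  using assms sublinear_scale_pos [of q t x] sublinear_zero [of q] by (cases "t = 0") auto

lemma sublinear_minus_ge: "sublinear q \<Longrightarrow> - q (- x) \<le> q x"
  using sublinear_add [of q x "- x"] sublinear_zero [of q] by simp

text \<open>
  For sublinear \<open>q\<close>, the largest sublinear functional below \<open>q\<close> whose value at \<open>- v\<close> is at most \<open>- q v\<close>. It serves
  twice: a minimal sublinear functional must agree with all its push-downs, hence be odd, and a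
  linear functional below \<open>push_down q v\<close> has value at least \<open>q v\<close> at \<open>v\<close>.
\<close>
definition push_down :: "('a::real_vector \<Rightarrow> real) \<Rightarrow> 'a \<Rightarrow> 'a \<Rightarrow> real"
  where "push_down q v x = (INF t\<in>{0..}. q (x + t *\<^sub>R v) - t * q v)"

lemma push_down_lower:
  assumes q: "sublinear q" and t: "t \<ge> 0"
  shows "- q (- x) \<le> q (x + t *\<^sub>R v) - t * q v"
  using sublinear_add [OF q, of "x + t *\<^sub>R v" "- x"] sublinear_scale [OF q t, of v] by simp

lemma push_down_le:
  assumes q: "sublinear q" and t: "t \<ge> 0"
  shows "push_down q v x \<le> q (x + t *\<^sub>R v) - t * q v"
  unfolding push_down_def
  using t push_down_lower [OF q] by (intro cINF_lower) (auto intro!: bdd_belowI2)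

lemma push_down_greatest:
  assumes "\<And>t. t \<ge> 0 \<Longrightarrow> b \<le> q (x + t *\<^sub>R v) - t * q v"
  shows "b \<le> push_down q v x"
  unfolding push_down_def using assms by (intro cINF_greatest) auto

lemma sublinear_push_down:
  assumes q: "sublinear q"
  shows "sublinear (push_down q v)"
  unfolding sublinear_def
proof (intro conjI allI impI)
  fix x y
  have *: "push_down q v (x + y) - (q (y + t *\<^sub>R v) - t * q v) \<le> q (x + s *\<^sub>R v) - s * q v"
    if "s \<ge> 0" "t \<ge> 0" for s t
  proof -
    have "push_down q v (x + y) \<le> q (x + y + (s + t) *\<^sub>R v) - (s + t) * q v"
      using that by (intro push_down_le q) auto
    also have "x + y + (s + t) *\<^sub>R v = (x + s *\<^sub>R v) + (y + t *\<^sub>R v)"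
      by (simp add: algebra_simps)
    also have "q \<dots> \<le> q (x + s *\<^sub>R v) + q (y + t *\<^sub>R v)"
      by (rule sublinear_add [OF q])
    finally show ?thesis by (simp add: algebra_simps)
  qed
  have "push_down q v (x + y) - push_down q v x \<le> q (y + t *\<^sub>R v) - t * q v" if "t \<ge> 0" for t
    using push_down_greatest [OF *, of t] that by (smt (verit))
  then have "push_down q v (x + y) - push_down q v x \<le> push_down q v y"
    by (rule push_down_greatest)
  then show "push_down q v (x + y) \<le> push_down q v x + push_down q v y"
    by simp
next
  fix r :: real and x assume r: "r > 0"
  have "push_down q v (r *\<^sub>R x) / r \<le> q (x + t *\<^sub>R v) - t * q v" if "t \<ge> 0" for t
  proof -
    have "push_down q v (r *\<^sub>R x) \<le> q (r *\<^sub>R x + (r * t) *\<^sub>R v) - (r * t) * q v"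
      using that r by (intro push_down_le q) auto
    also have "q (r *\<^sub>R x + (r * t) *\<^sub>R v) = r * q (x + t *\<^sub>R v)"
      using sublinear_scale_pos [OF q r, of "x + t *\<^sub>R v"] by (simp add: algebra_simps)
    finally show ?thesis
      using r by (simp add: field_simps)
  qed
  then have "push_down q v (r *\<^sub>R x) / r \<le> push_down q v x"
    by (rule push_down_greatest)
  then show "push_down q v (r *\<^sub>R x) \<le> r * push_down q v x"
    using r by (simp add: field_simps)
qed

lemma push_down_below: "sublinear q \<Longrightarrow> push_down q v x \<le> q x"
  using push_down_le [of q 0 v x] by simp

lemma push_down_neg:
  assumes "sublinear q"
  shows "push_down q v (- v) \<le> - q v"
  using push_down_le [OF assms, of 1 v "- v"] sublinear_zero [OF assms] by simp

lemma sublinear_Inf_chain: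
  assumes ne: "\<C> \<noteq> {}" and sub: "\<And>q. q \<in> \<C> \<Longrightarrow> sublinear q"
    and chain: "\<And>q r. q \<in> \<C> \<Longrightarrow> r \<in> \<C> \<Longrightarrow> q \<le> r \<or> r \<le> q"
    and bdd: "\<And>x. bdd_below ((\<lambda>q. q x) ` \<C>)"
  shows "sublinear (\<lambda>x. INF q\<in>\<C>. q x)"
  unfolding sublinear_def
proof (intro conjI allI impI)
  fix x y
  have low: "(INF q\<in>\<C>. q x) \<le> r x" if "r \<in> \<C>" for r x
    using bdd that by (rule cINF_lower)
  have *: "(INF q\<in>\<C>. q (x + y)) - s y \<le> r x" if rs: "r \<in> \<C>" "s \<in> \<C>" for r s
  proof -
    obtain q where q: "q \<in> \<C>" "q \<le> r" "q \<le> s"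
      using chain [OF rs] rs by blast
    have "(INF q\<in>\<C>. q (x + y)) \<le> q (x + y)"
      by (rule low [OF q(1)])
    also have "\<dots> \<le> q x + q y"
      by (rule sublinear_add [OF sub [OF q(1)]])
    also have "\<dots> \<le> r x + s y"
      using q(2,3) by (simp add: le_fun_def add_mono)
    finally show ?thesis by simp
  qed
  have "(INF q\<in>\<C>. q (x + y)) - s y \<le> (INF q\<in>\<C>. q x)" if "s \<in> \<C>" for s
    using * that ne by (intro cINF_greatest) auto
  then have "(INF q\<in>\<C>. q (x + y)) - (INF q\<in>\<C>. q x) \<le> (INF q\<in>\<C>. q y)"
    using ne by (intro cINF_greatest) (auto simp: algebra_simps)
  then show "(INF q\<in>\<C>. q (x + y)) \<le> (INF q\<in>\<C>. q x) + (INF q\<in>\<C>. q y)"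
    by simp
next
  fix t :: real and x assume t: "t > 0"
  have "(INF q\<in>\<C>. q (t *\<^sub>R x)) / t \<le> r x" if "r \<in> \<C>" for r
  proof -
    have "(INF q\<in>\<C>. q (t *\<^sub>R x)) \<le> r (t *\<^sub>R x)"
      using bdd that by (rule cINF_lower)
    also have "\<dots> = t * r x"
      by (rule sublinear_scale_pos [OF sub [OF that] t])
    finally show ?thesis
      using t by (simp add: field_simps)
  qed
  then have "(INF q\<in>\<C>. q (t *\<^sub>R x)) / t \<le> (INF q\<in>\<C>. q x)"
    using ne by (intro cINF_greatest)
  then show "(INF q\<in>\<C>. q (t *\<^sub>R x)) \<le> t * (INF q\<in>\<C>. q x)"
    using t by (simp add: field_simps)
qed

text \<open>
  The Hahn--Banach theorem. By Zorn's lemma there is a minimal sublinear functional below \<open>p\<close>;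
  pushing it down in any direction leaves it unchanged, so it is odd, and an odd
  sublinear functional is linear.
\<close>
lemma linear_below_sublinear:
  assumes p: "sublinear p"
  obtains f where "linear f" "\<And>x. f x \<le> p x"
proof -
  define A where "A = {q. sublinear q \<and> q \<le> p}"
  have low: "- p (- x) \<le> q x" if "q \<in> A" for q x
    using that sublinear_minus_ge [of q x] le_funD [of q p "- x"] by (auto simp: A_def)
  have "\<exists>m\<in>A. \<forall>a\<in>A. a \<le> m \<longrightarrow> a = m"
  proof (rule predicate_Zorn)
    show "partial_order_on A (relation_of (\<lambda>q r. r \<le> q) A)"
      by (rule partial_order_on_relation_ofI) auto
  next
    fix \<C> assume C: "\<C> \<in> Chains (relation_of (\<lambda>q r. r \<le> q) A)"
    then have CA: "\<C> \<subseteq> A"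
      by (auto simp: Chains_def relation_of_def)
    show "\<exists>u\<in>A. \<forall>a\<in>\<C>. u \<le> a"
    proof (cases "\<C> = {}")
      case True
      then show ?thesis
        using p by (auto simp: A_def)
    next
      case False
      define u where "u = (\<lambda>x. INF q\<in>\<C>. q x)"
      have bdd: "bdd_below ((\<lambda>q. q x) ` \<C>)" for x
        using low CA by (intro bdd_belowI2 [of _ "- p (- x)"]) auto
      have ua: "u \<le> a" if "a \<in> \<C>" for a
        unfolding u_def le_fun_def using cINF_lower [OF bdd that] by blast
      have "sublinear u"
        unfolding u_def
      proof (rule sublinear_Inf_chain [OF False])
        show "q \<le> r \<or> r \<le> q" if "q \<in> \<C>" "r \<in> \<C>" for q r
          using C that by (auto simp: Chains_def relation_of_def)
      qed (use CA bdd in \<open>auto simp: A_def\<close>)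
      moreover have "u \<le> p"
        using False ua CA by (force simp: A_def intro: order_trans)
      ultimately show ?thesis
        using ua by (auto simp: A_def)
    qed
  qed
  then obtain f where f: "sublinear f" "f \<le> p" and min: "\<And>a. sublinear a \<Longrightarrow> a \<le> f \<Longrightarrow> a = f"
    unfolding A_def by (metis (no_types, lifting) mem_Collect_eq order_trans)
  have odd: "f (- v) = - f v" for v
  proof -
    have "push_down f v = f"
      using f(1) by (intro min sublinear_push_down le_funI push_down_below)
    then have "f (- v) \<le> - f v"
      using push_down_neg [OF f(1), of v] by simp
    then show ?thesis
      using sublinear_minus_ge [OF f(1), of "- v"] by simp
  qed
  have "linear f"
  proof (rule linearI)
    fix x y
    have "f (- x + - y) \<le> f (- x) + f (- y)"
      by (rule sublinear_add [OF f(1)])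
    then have "f x + f y \<le> f (x + y)"
      using odd [of "x + y"] odd [of x] odd [of y] by simp
    then show "f (x + y) = f x + f y"
      using sublinear_add [OF f(1), of x y] by simp
  next
    fix t :: real and x
    show "f (t *\<^sub>R x) = t *\<^sub>R f x"
    proof (cases "t \<ge> 0")
      case True
      then show ?thesis by (simp add: sublinear_scale [OF f(1)])
    next
      case False
      then show ?thesis
        using sublinear_scale [OF f(1), of "- t" x] odd [of "t *\<^sub>R x"] by simp
    qed
  qed
  then show ?thesis
    using that f(2) by (auto simp: le_fun_def)
qed

text \<open>
  The distance from \<open>- x\<close> to the cone is a sublinear function of \<open>x\<close> that is dominated by the
  norm, is at least \<open>d\<close> at \<open>v\<close> and vanishes on \<open>- C\<close>. Any linear functional below it that is
  exact at \<open>v\<close> therefore has all the required properties.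
\<close>
lemma functional_nonneg_on_cone:
  fixes C :: "'a::real_normed_vector set"
  assumes zero: "0 \<in> C"
    and add: "\<And>x y. x \<in> C \<Longrightarrow> y \<in> C \<Longrightarrow> x + y \<in> C"
    and scale: "\<And>t x. t > 0 \<Longrightarrow> x \<in> C \<Longrightarrow> t *\<^sub>R x \<in> C"
    and dist: "\<And>c. c \<in> C \<Longrightarrow> d \<le> norm (v + c)"
  obtains f :: "'a \<Rightarrow>\<^sub>L real"
  where "norm f \<le> 1" "d \<le> f v" "\<And>c. c \<in> C \<Longrightarrow> 0 \<le> f c"
proof -
  define p where "p x = (INF c\<in>C. norm (x + c))" for x
  have ple: "p x \<le> norm (x + c)" if "c \<in> C" for x c
    unfolding p_def using that by (intro cINF_lower) (auto intro!: bdd_belowI2 [of _ 0])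
  have pge: "b \<le> p x" if "\<And>c. c \<in> C \<Longrightarrow> b \<le> norm (x + c)" for b x
    unfolding p_def using zero that by (intro cINF_greatest) auto
  have p: "sublinear p"
    unfolding sublinear_def
  proof (intro conjI allI impI)
    fix x y
    have *: "p (x + y) - norm (y + c) \<le> norm (x + b)" if "b \<in> C" "c \<in> C" for b c
    proof -
      have "p (x + y) \<le> norm (x + y + (b + c))"
        using that by (intro ple add)
      also have "\<dots> = norm ((x + b) + (y + c))"
        by (simp add: algebra_simps)
      also have "\<dots> \<le> norm (x + b) + norm (y + c)"
        by (rule norm_triangle_ineq)
      finally show ?thesis by simp
    qed
    have "p (x + y) - p x \<le> norm (y + c)" if "c \<in> C" for c
      using pge [OF *, of c] that by (smt (verit))
    then show "p (x + y) \<le> p x + p y"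
      using pge [of "p (x + y) - p x" y] by simp
  next
    fix t :: real and x assume t: "t > 0"
    have "p (t *\<^sub>R x) / t \<le> norm (x + c)" if "c \<in> C" for c
    proof -
      have "p (t *\<^sub>R x) \<le> norm (t *\<^sub>R x + t *\<^sub>R c)"
        using that t by (intro ple scale)
      also have "\<dots> = t * norm (x + c)"
        using t by (simp flip: scaleR_add_right)
      finally show ?thesis
        using t by (simp add: field_simps)
    qed
    then have "p (t *\<^sub>R x) / t \<le> p x"
      by (rule pge)
    then show "p (t *\<^sub>R x) \<le> t * p x"
      using t by (simp add: field_simps)
  qed
  obtain f where f: "linear f" "\<And>x. f x \<le> push_down p v x"
    using linear_below_sublinear [OF sublinear_push_down [OF p, of v]] by blast
  have fp: "f x \<le> p x" for x
    using f(2) push_down_below [OF p] order_trans by blast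
  have "p x \<le> norm x" for x
    using ple [OF zero, of x] by simp
  then have "f x \<le> norm x" for x
    using fp order_trans by blast
  then have abs: "\<bar>f x\<bar> \<le> norm x" for x
    by (metis abs_le_iff f(1) linear_neg norm_minus_cancel)
  have bl: "bounded_linear f"
    using f(1) abs by (intro bounded_linear_intro [where K = 1])
      (auto simp: linear_add linear_scale)
  show ?thesis
  proof
    show "norm (Blinfun f) \<le> 1"
      using abs by (intro norm_blinfun_bound) (auto simp: bounded_linear_Blinfun_apply [OF bl])
    have "d \<le> p v"
      using dist by (rule pge)
    also have "p v \<le> f v"
      using f(2) [of "- v"] push_down_neg [OF p, of v] linear_neg [OF f(1), of v] by simp
    finally show "d \<le> Blinfun f v"
      by (simp add: bounded_linear_Blinfun_apply [OF bl])
    show "0 \<le> Blinfun f c" if "c \<in> C" for c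
      using fp [of "- c"] ple [OF that, of "- c"] linear_neg [OF f(1), of c]
      by (simp add: bounded_linear_Blinfun_apply [OF bl])
  qed
qed

text \<open>
  Replacing \<open>f\<close> by \<open>- f\<close> exchanges the two points of a pair, so only pairs with \<open>i < j\<close> matter. The
  terms of the sequence are automatically distinct, because the functionals separate them.
\<close>
lemma Ka_setI:
  fixes u :: "nat \<Rightarrow> 'a::real_normed_vector"
  assumes d: "d > 0" and u: "\<And>i. norm (u i) \<le> 1"
    and f: "\<And>i j. i < j \<Longrightarrow> \<exists>f :: 'a \<Rightarrow>\<^sub>L real. norm f \<le> 1 \<and> d \<le> blinfun_apply f (u j) - blinfun_apply f (u i) \<and>
              (\<forall>k. blinfun_apply f (u i) \<le> blinfun_apply f (u k) \<and> blinfun_apply f (u k) \<le> blinfun_apply f (u j))"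
  shows "d \<in> Ka_set TYPE('a)"
proof -
  have g: "\<exists>f :: 'a \<Rightarrow>\<^sub>L real. norm f \<le> 1 \<and> d \<le> blinfun_apply f (u j) - blinfun_apply f (u i) \<and>
              (\<forall>k. blinfun_apply f (u i) \<le> blinfun_apply f (u k) \<and> blinfun_apply f (u k) \<le> blinfun_apply f (u j))" if "i \<noteq> j" for i j
  proof (cases "i < j")
    case True
    then show ?thesis by (rule f)
  next
    case False
    with that have "j < i" by simp
    from f [OF this] obtain f :: "'a \<Rightarrow>\<^sub>L real" where "norm f \<le> 1" "d \<le> f (u i) - f (u j)"
      "\<forall>k. f (u j) \<le> f (u k) \<and> f (u k) \<le> f (u i)"
      by blast
    then show ?thesis
      by (intro exI [of _ "- f"]) (auto simp: uminus_blinfun.rep_eq)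
  qed
  have "inj u"
    using g d by (intro injI) (metis diff_self not_less)
  then have "infinite (range u)"
    using finite_imageD by blast
  moreover have "bsa 1 1 d (range u)"
    unfolding bsa_def
  proof (intro conjI ballI impI)
    fix x y assume "x \<in> range u" "y \<in> range u" "x \<noteq> y"
    then obtain i j where "x = u i" "y = u j" "i \<noteq> j" by blast
    then show "\<exists>f :: 'a \<Rightarrow>\<^sub>L real. norm f \<le> 1 \<and> d \<le> blinfun_apply f y - blinfun_apply f x \<and>
        (\<forall>z\<in>range u. blinfun_apply f x \<le> blinfun_apply f z \<and> blinfun_apply f z \<le> blinfun_apply f y)"
      using g [of i j] by simp
  qed (use u in auto)
  ultimately show ?thesis
    using d u unfolding Ka_set_def by (intro CollectI conjI exI [of _ "range u"]) auto
qed

section \<open>Isomorphic embeddings of finitely supported sequences\<close>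

text \<open>
  Restricting to finitely supported sequences makes every block finite, so that the next one
  can start after it, and treats \<open>c_0\<close> and all \<open>l_p\<close> alike.
\<close>
definition finite_tails :: "nat \<Rightarrow> (nat \<Rightarrow> real) set"
  where "finite_tails n = {x. finite {t. x t \<noteq> 0} \<and> (\<forall>t<n. x t = 0)}"

lemma finite_tails_zero: "(\<lambda>t. 0) \<in> finite_tails n"
  by (simp add: finite_tails_def)

lemma finite_tails_add:
  assumes "x \<in> finite_tails n" "y \<in> finite_tails n"
  shows "(\<lambda>t. x t + y t) \<in> finite_tails n"
proof -
  have "finite ({t. x t \<noteq> 0} \<union> {t. y t \<noteq> 0})"
    using assms by (simp add: finite_tails_def)
  then have "finite {t. x t + y t \<noteq> 0}"
    by (rule rev_finite_subset) auto
  then show ?thesis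
    using assms by (simp add: finite_tails_def)
qed

lemma finite_tails_scale:
  assumes "x \<in> finite_tails n"
  shows "(\<lambda>t. c * x t) \<in> finite_tails n"
proof -
  have "finite {t. c * x t \<noteq> 0}"
    using assms by (auto simp: finite_tails_def intro: rev_finite_subset)
  then show ?thesis
    using assms by (simp add: finite_tails_def)
qed

lemma finite_tails_minus: "x \<in> finite_tails n \<Longrightarrow> (\<lambda>t. - x t) \<in> finite_tails n"
  using finite_tails_scale [of x n "-1"] by simp

lemma finite_tails_sum:
  assumes "\<And>k. k \<in> K \<Longrightarrow> y k \<in> finite_tails n"
  shows "(\<lambda>t. \<Sum>k\<in>K. y k t) \<in> finite_tails n"
  using assms
  by (induction K rule: infinite_finite_induct)
    (auto simp: finite_tails_zero intro: finite_tails_add)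

lemma finite_tails_antimono: "m \<le> n \<Longrightarrow> finite_tails n \<subseteq> finite_tails m"
  by (auto simp: finite_tails_def)

lemma finite_tails_0: "x \<in> finite_tails n \<Longrightarrow> x \<in> finite_tails 0"
  by (simp add: finite_tails_def)

lemma finite_tails_subset_c0: "finite_tails 0 \<subseteq> c0_space"
proof
  fix x assume "x \<in> finite_tails 0"
  then have "finite {t. x t \<noteq> 0}"
    by (simp add: finite_tails_def)
  then have "\<forall>\<^sub>F t in cofinite. x t = 0"
    by (simp add: eventually_cofinite)
  then have "\<forall>\<^sub>F t in sequentially. x t = 0"
    by (simp add: cofinite_eq_sequentially)
  then show "x \<in> c0_space"
    by (simp add: c0_space_def tendsto_eventually)
qed

lemma finite_tails_subset_ell: "finite_tails 0 \<subseteq> ell_space p"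
proof
  fix x assume "x \<in> finite_tails 0"
  then have "finite {t. x t \<noteq> 0}"
    by (simp add: finite_tails_def)
  then show "x \<in> ell_space p"
    unfolding ell_space_def by (auto intro: summable_finite [of "{t. x t \<noteq> 0}"])
qed

lemma c0_norm_le: "(\<And>t. \<bar>x t\<bar> \<le> b) \<Longrightarrow> c0_norm x \<le> b"
  unfolding c0_norm_def by (rule cSUP_least) auto

lemma c0_norm_scale:
  assumes x: "x \<in> c0_space"
  shows "c0_norm (\<lambda>n. c * x n) = \<bar>c\<bar> * c0_norm x"
proof (cases "c = 0")
  case True
  then show ?thesis
    by (simp add: c0_norm_def)
next
  case False
  have cx: "(\<lambda>n. c * x n) \<in> c0_space"
    using x by (simp add: c0_space_def tendsto_mult_right_zero)
  show ?thesis
  proof (rule antisym)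
    show "c0_norm (\<lambda>n. c * x n) \<le> \<bar>c\<bar> * c0_norm x"
      using c0_norm_upper [OF x] by (intro c0_norm_le) (simp add: abs_mult mult_left_mono)
    have "c0_norm x \<le> c0_norm (\<lambda>n. c * x n) / \<bar>c\<bar>"
      using c0_norm_upper [OF cx] False
      by (intro c0_norm_le) (simp add: abs_mult field_simps)
    then show "\<bar>c\<bar> * c0_norm x \<le> c0_norm (\<lambda>n. c * x n)"
      using False by (simp add: field_simps)
  qed
qed

lemma ell_norm_scale:
  assumes p: "p \<ge> 1" and "x \<in> ell_space p"
  shows "ell_norm p (\<lambda>n. c * x n) = \<bar>c\<bar> * ell_norm p x"
proof -
  have s: "summable (\<lambda>n. \<bar>x n\<bar> powr p)"
    using assms by (simp add: ell_space_def)
  have "(\<Sum>n. \<bar>c * x n\<bar> powr p) = \<bar>c\<bar> powr p * (\<Sum>n. \<bar>x n\<bar> powr p)"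
    using suminf_mult [OF s, of "\<bar>c\<bar> powr p"] by (simp add: abs_mult powr_mult)
  then show ?thesis
    using p suminf_nonneg [OF s] by (simp add: ell_norm_def powr_mult powr_powr)
qed

text \<open>
  All that is kept of an isomorphic copy: a linear map on the finitely supported sequences that
  is bounded above and below.
\<close>
locale embedding_of_finite_seqs =
  fixes T :: "(nat \<Rightarrow> real) \<Rightarrow> 'a::real_normed_vector"
    and N :: "(nat \<Rightarrow> real) \<Rightarrow> real" and C :: real
  assumes T_add: "x \<in> finite_tails 0 \<Longrightarrow> y \<in> finite_tails 0 \<Longrightarrow> T (\<lambda>t. x t + y t) = T x + T y"
    and T_scale: "x \<in> finite_tails 0 \<Longrightarrow> T (\<lambda>t. c * x t) = c *\<^sub>R T x"
    and N_scale: "x \<in> finite_tails 0 \<Longrightarrow> N (\<lambda>t. c * x t) = \<bar>c\<bar> * N x"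
    and N_pos: "x \<in> finite_tails 0 \<Longrightarrow> x t \<noteq> 0 \<Longrightarrow> N x > 0"
    and C_pos: "C > 0"
    and T_le: "x \<in> finite_tails 0 \<Longrightarrow> norm (T x) \<le> C * N x"
    and N_le: "x \<in> finite_tails 0 \<Longrightarrow> N x \<le> C * norm (T x)"

text \<open>
  Stated for arbitrary homogeneous functions \<open>q\<close> and \<open>r\<close> because it is used in both directions: the
  roles of \<open>N x\<close> and \<open>norm (T x)\<close> are exchanged for the inverse of the embedding.
\<close>
lemma linear_bound_from_ball:
  fixes q r :: "'b \<Rightarrow> real" and s :: "real \<Rightarrow> 'b \<Rightarrow> 'b"
  assumes \<delta>: "\<delta> > 0"
    and ball: "\<And>x. x \<in> V \<Longrightarrow> q x < \<delta> \<Longrightarrow> r x < 1"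
    and V: "\<And>c x. x \<in> V \<Longrightarrow> s c x \<in> V"
    and q: "\<And>c x. x \<in> V \<Longrightarrow> q (s c x) = \<bar>c\<bar> * q x" "\<And>x. x \<in> V \<Longrightarrow> q x \<ge> 0"
    and r: "\<And>c x. x \<in> V \<Longrightarrow> r (s c x) = \<bar>c\<bar> * r x"
    and x: "x \<in> V"
  shows "r x \<le> (1 / \<delta>) * q x"
proof (rule ccontr)
  assume "\<not> ?thesis"
  then have *: "q x < \<delta> * r x"
    using \<delta> by (simp add: field_simps)
  then have "r x > 0"
    using q(2) [OF x] \<delta> by (smt (verit) mult_nonneg_nonpos)
  then have "q (s (1 / r x) x) < \<delta>" "r (s (1 / r x) x) = 1"
    using * by (simp_all add: q(1) [OF x] r [OF x] field_simps)
  then show False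
    using ball [OF V [OF x], of "1 / r x"] by simp
qed

text \<open>
  A linear homeomorphism is bounded above and below. The upper bound uses that the preimage of
  the unit ball is a neighbourhood of \<open>0\<close>, the lower bound that the image of the unit ball is one.
\<close>
lemma isomorphic_copy_embedding:
  assumes copy: "contains_isomorphic_copy TYPE('a::real_normed_vector) V N"
    and M: "Metric_space V (norm_dist V N)"
    and fin: "finite_tails 0 \<subseteq> V"
    and Vscale: "\<And>c x. x \<in> V \<Longrightarrow> (\<lambda>n. c * x n) \<in> V"
    and Nscale: "\<And>c x. x \<in> V \<Longrightarrow> N (\<lambda>n. c * x n) = \<bar>c\<bar> * N x"
  obtains T :: "(nat \<Rightarrow> real) \<Rightarrow> 'a::real_normed_vector" and C where "embedding_of_finite_seqs T N C"
proof -
  interpret M: Metric_space V "norm_dist V N" by (rule M)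
  obtain Z and T :: "(nat \<Rightarrow> real) \<Rightarrow> 'a" where lin: "linear_on_seqs V T"
    and homeo: "homeomorphic_map (norm_topology V N) (top_of_set Z) T"
    using copy unfolding contains_isomorphic_copy_def by blast
  have homeo': "homeomorphic_map M.mtopology (top_of_set Z) T"
    using homeo by (simp add: norm_topology_def)
  have zero: "(\<lambda>n. 0) \<in> V"
    using fin finite_tails_zero by blast
  have Tscale: "T (\<lambda>n. c * x n) = c *\<^sub>R T x" if "x \<in> V" for c x
    using lin that by (simp add: linear_on_seqs_def)
  have Tscale_norm: "norm (T (\<lambda>n. c * x n)) = \<bar>c\<bar> * norm (T x)" if "x \<in> V" for c x
    using Tscale [OF that] by simp
  have T0: "T (\<lambda>n. 0) = 0"
    using Tscale [OF zero, of 0] by simp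
  have dist0: "norm_dist V N (\<lambda>n. 0) x = N x" if "x \<in> V" for x
    using that zero Nscale [OF that, of "-1"] by (simp add: norm_dist_def)
  have Nnn: "N x \<ge> 0" if "x \<in> V" for x
    using M.nonneg [of "\<lambda>n. 0" x] dist0 [OF that] by simp
  have Tim: "T ` V = Z" and Tinj: "inj_on T V"
    using homeomorphic_imp_surjective_map [OF homeo'] homeomorphic_imp_injective_map [OF homeo']
    by simp_all
  have open_pre: "openin M.mtopology {x \<in> V. T x \<in> ball 0 1}"
  proof -
    have "openin (top_of_set Z) (Z \<inter> ball 0 1)"
      by (simp add: openin_open_Int)
    then have "openin M.mtopology {x \<in> topspace M.mtopology. T x \<in> Z \<inter> ball 0 1}"
      using homeomorphic_imp_continuous_map [OF homeo']
      by (intro openin_continuous_map_preimage)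
    moreover have "{x \<in> topspace M.mtopology. T x \<in> Z \<inter> ball 0 1} = {x \<in> V. T x \<in> ball 0 1}"
      using Tim by auto
    ultimately show ?thesis by simp
  qed
  have "(\<lambda>n. 0) \<in> {x \<in> V. T x \<in> ball 0 1}"
    using zero T0 by simp
  then obtain \<delta> where \<delta>: "\<delta> > 0" "M.mball (\<lambda>n. 0) \<delta> \<subseteq> {x \<in> V. T x \<in> ball 0 1}"
    using open_pre unfolding M.openin_mtopology by blast
  have ball1: "norm (T x) < 1" if "x \<in> V" "N x < \<delta>" for x
  proof -
    have "x \<in> M.mball (\<lambda>n. 0) \<delta>"
      using that zero dist0 [OF that(1)] by (simp add: M.in_mball)
    then show ?thesis
      using \<delta>(2) by auto
  qed
  have bound1: "norm (T x) \<le> (1 / \<delta>) * N x" if "x \<in> V" for x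
    by (rule linear_bound_from_ball [where V = V and s = "\<lambda>c x n. c * x n" and q = N])
       (use \<delta>(1) ball1 Vscale Nscale Nnn Tscale_norm that in auto)
  have "openin (top_of_set Z) (T ` M.mball (\<lambda>n. 0) 1)"
    using homeomorphic_imp_open_map [OF homeo'] M.openin_mball by (auto simp: open_map_def)
  moreover have "0 \<in> T ` M.mball (\<lambda>n. 0) 1"
    using T0 zero by (metis M.centre_in_mball_iff imageI zero_less_one)
  ultimately obtain \<epsilon> where \<epsilon>: "\<epsilon> > 0" "ball 0 \<epsilon> \<inter> Z \<subseteq> T ` M.mball (\<lambda>n. 0) 1"
    by (meson openin_contains_ball)
  have ball2: "N x < 1" if "x \<in> V" "norm (T x) < \<epsilon>" for x
  proof -
    have "T x \<in> ball 0 \<epsilon> \<inter> Z"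
      using that Tim by auto
    then obtain y where "y \<in> M.mball (\<lambda>n. 0) 1" "T x = T y"
      using \<epsilon>(2) by blast
    then have "x \<in> M.mball (\<lambda>n. 0) 1"
      using Tinj that(1) by (auto simp: M.in_mball inj_on_def)
    then show ?thesis
      using dist0 [OF that(1)] by (simp add: M.in_mball)
  qed
  have bound2: "N x \<le> (1 / \<epsilon>) * norm (T x)" if "x \<in> V" for x
    by (rule linear_bound_from_ball [where V = V and s = "\<lambda>c x n. c * x n" and r = N])
       (use \<epsilon>(1) ball2 Vscale Nscale Tscale_norm that in auto)
  define C where "C = max (1 / \<delta>) (1 / \<epsilon>)"
  have "embedding_of_finite_seqs T N C"
  proof
    fix x assume x: "x \<in> finite_tails 0"
    then have xV: "x \<in> V" using fin by blast
    show "T (\<lambda>t. x t + y t) = T x + T y" if "y \<in> finite_tails 0" for y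
      using lin xV that fin unfolding linear_on_seqs_def by blast
    show "T (\<lambda>t. c * x t) = c *\<^sub>R T x" for c
      by (rule Tscale [OF xV])
    show "N (\<lambda>t. c * x t) = \<bar>c\<bar> * N x" for c
      by (rule Nscale [OF xV])
    show "N x > 0" if "x t \<noteq> 0" for t
      using M.zero [OF zero xV] that Nnn [OF xV] dist0 [OF xV] by (auto simp: less_le)
    have "(1 / \<delta>) * N x \<le> C * N x"
      using Nnn [OF xV] by (intro mult_right_mono) (auto simp: C_def)
    then show "norm (T x) \<le> C * N x"
      using bound1 [OF xV] by linarith
    have "(1 / \<epsilon>) * norm (T x) \<le> C * norm (T x)"
      by (intro mult_right_mono) (auto simp: C_def)
    then show "N x \<le> C * norm (T x)"
      using bound2 [OF xV] by linarith
  next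
    show "C > 0"
      using \<delta>(1) by (simp add: C_def less_max_iff_disj)
  qed
  then show ?thesis by (rule that)
qed

section \<open>Blocks on which two equivalent norms are almost proportional\<close>

lemma disjoint_blocks:
  assumes ex: "\<And>m. \<exists>x\<in>finite_tails m. P x"
  obtains y :: "nat \<Rightarrow> nat \<Rightarrow> real"
  where "\<And>k. y k \<in> finite_tails n" "\<And>k. P (y k)" "\<And>k l t. k \<noteq> l \<Longrightarrow> y k t = 0 \<or> y l t = 0"
proof -
  have "\<exists>x h. x \<in> finite_tails m \<and> P x \<and> m \<le> h \<and> (\<forall>t\<ge>h. x t = 0)" for m
  proof -
    obtain x where x: "x \<in> finite_tails m" "P x"
      using ex by blast
    then have "finite {t. x t \<noteq> 0}"
      by (simp add: finite_tails_def)
    then obtain h where h: "\<forall>t\<in>{t. x t \<noteq> 0}. t < h"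
      using finite_nat_set_iff_bounded by blast
    then have "\<forall>t\<ge>max m h. x t = 0"
      by fastforce
    then show ?thesis
      using x by (intro exI [of _ x] exI [of _ "max m h"]) auto
  qed
  then obtain g h where gh: "\<And>m. g m \<in> finite_tails m" "\<And>m. P (g m)" "\<And>m. m \<le> h m"
      "\<And>m t. h m \<le> t \<Longrightarrow> g m t = 0"
    by metis
  define m where "m k = (h ^^ k) n" for k
  have m_Suc: "m (Suc k) = h (m k)" for k
    by (simp add: m_def)
  have "incseq m"
    using gh(3) by (intro incseq_SucI) (simp add: m_Suc)
  have disj: "g (m k) t = 0 \<or> g (m l) t = 0" if "k < l" for k l t
  proof (cases "t < m l")
    case True
    then show ?thesis
      using gh(1) [of "m l"] by (simp add: finite_tails_def)
  next
    case False
    have "m (Suc k) \<le> m l"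
      using incseqD [OF \<open>incseq m\<close>, of "Suc k" l] that by simp
    then show ?thesis
      using False gh(4) [of "m k" t] by (simp add: m_Suc)
  qed
  show ?thesis
  proof (rule that [of "\<lambda>k. g (m k)"])
    show "g (m k) \<in> finite_tails n" for k
    proof -
      have "n \<le> m k"
        using \<open>incseq m\<close> incseqD [of m 0 k] by (simp add: m_def)
      then show ?thesis
        using gh(1) finite_tails_antimono by blast
    qed
    show "g (m k) t = 0 \<or> g (m l) t = 0" if "k \<noteq> l" for k l t
      using that disj [of k l t] disj [of l k t] by (auto simp: neq_iff)
  qed (rule gh(2))
qed

text \<open>
  Let \<open>K\<close> be the set of constants \<open>\<alpha>\<close> for which \<open>A \<le> \<alpha> B\<close> holds on some tail, and \<open>\<beta>\<close> its infimum,
  which is positive because \<open>B \<le> C A\<close>. A constant \<open>\<alpha> \<in> K\<close> slightly above \<open>\<beta>\<close> has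
  \<open>\<theta> * \<alpha> < \<beta>\<close>; hence \<open>\<theta> * \<alpha> \<notin> K\<close>, so that every tail contains a vector with \<open>A > \<theta> \<alpha> B\<close>.
\<close>
lemma almost_proportional_blocks:
  fixes A B :: "(nat \<Rightarrow> real) \<Rightarrow> real"
  assumes A: "\<And>c x. x \<in> finite_tails 0 \<Longrightarrow> A (\<lambda>t. c * x t) = \<bar>c\<bar> * A x"
    and B: "\<And>c x. x \<in> finite_tails 0 \<Longrightarrow> B (\<lambda>t. c * x t) = \<bar>c\<bar> * B x"
    and Apos: "\<And>x t. x \<in> finite_tails 0 \<Longrightarrow> x t \<noteq> 0 \<Longrightarrow> A x > 0"
    and C: "C > 0" "\<And>x. x \<in> finite_tails 0 \<Longrightarrow> A x \<le> C * B x"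
      "\<And>x. x \<in> finite_tails 0 \<Longrightarrow> B x \<le> C * A x"
    and \<theta>: "0 < \<theta>" "\<theta> < 1"
  obtains \<alpha> n and y :: "nat \<Rightarrow> nat \<Rightarrow> real" where "\<alpha> > 0" "\<And>x. x \<in> finite_tails n \<Longrightarrow> A x \<le> \<alpha> * B x"
    "\<And>k. y k \<in> finite_tails n" "\<And>k. B (y k) = 1" "\<And>k. \<theta> * \<alpha> \<le> A (y k)"
    "\<And>k l t. k \<noteq> l \<Longrightarrow> y k t = 0 \<or> y l t = 0"
proof -
  define K where "K = {\<alpha>. \<exists>n. \<forall>x\<in>finite_tails n. A x \<le> \<alpha> * B x}"
  have "C \<in> K"
    using C(2) unfolding K_def by blast
  have K_ge: "1 / C \<le> \<alpha>" if "\<alpha> \<in> K" for \<alpha>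
  proof -
    obtain n where n: "\<And>x. x \<in> finite_tails n \<Longrightarrow> A x \<le> \<alpha> * B x"
      using \<open>\<alpha> \<in> K\<close> by (auto simp: K_def)
    \<comment> \<open>A single nonzero vector of the tail already forces \<open>\<alpha>\<close> to be at least \<open>1 / C\<close>.\<close>
    define e :: "nat \<Rightarrow> real" where "e t = (if t = n then 1 else 0)" for t
    have e: "e \<in> finite_tails n"
      by (simp add: e_def finite_tails_def)
    have pos: "A e > 0"
      using finite_tails_0 [OF e] by (rule Apos [where t = n]) (simp add: e_def)
    have "A e \<le> C * B e"
      by (rule C(2) [OF finite_tails_0 [OF e]])
    with pos have Bpos: "B e > 0"
      using C(1) by (smt (verit) mult_nonneg_nonpos)
    have "B e \<le> C * A e"
      by (rule C(3) [OF finite_tails_0 [OF e]])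
    also have "\<dots> \<le> C * (\<alpha> * B e)"
      using C(1) n [OF e] by (intro mult_left_mono) auto
    finally have "1 * B e \<le> (C * \<alpha>) * B e"
      by (simp add: mult.assoc)
    then have "1 \<le> C * \<alpha>"
      using Bpos mult_le_cancel_right_pos by blast
    then show ?thesis
      using C(1) by (simp add: field_simps)
  qed
  define \<beta> where "\<beta> = Inf K"
  have "bdd_below K"
    using K_ge by (rule bdd_belowI)
  have "1 / C \<le> \<beta>"
    unfolding \<beta>_def using \<open>C \<in> K\<close> K_ge by (intro cInf_greatest) auto
  then have "\<beta> > 0"
    using C(1) by (smt (verit) zero_less_divide_1_iff)
  then have "\<beta> < \<beta> / \<theta>"
    using \<theta> by (simp add: field_simps)
  then obtain \<alpha> where \<alpha>: "\<alpha> \<in> K" "\<alpha> < \<beta> / \<theta>"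
    unfolding \<beta>_def using \<open>C \<in> K\<close> cInf_lessD by (metis empty_iff)
  have "\<alpha> > 0"
    using K_ge [OF \<alpha>(1)] C(1) by (smt (verit) zero_less_divide_1_iff)
  have "\<theta> * \<alpha> < \<beta>"
    using \<alpha>(2) \<theta>(1) by (simp add: field_simps)
  then have notin: "\<theta> * \<alpha> \<notin> K"
    unfolding \<beta>_def using cInf_lower [OF _ \<open>bdd_below K\<close>] by (meson not_le)
  have ex: "\<exists>x\<in>finite_tails m. B x = 1 \<and> \<theta> * \<alpha> \<le> A x" for m
  proof -
    obtain x where x: "x \<in> finite_tails m" "\<theta> * \<alpha> * B x < A x"
      using notin unfolding K_def by (auto simp: not_le)
    note x0 = finite_tails_0 [OF x(1)]
    have "\<exists>t. x t \<noteq> 0"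
    proof (rule ccontr)
      assume "\<nexists>t. x t \<noteq> 0"
      then have "x = (\<lambda>t. 0)" by auto
      then have "A x = 0" "B x = 0"
        using A [OF x0, of 0] B [OF x0, of 0] by simp_all
      then show False
        using x(2) by simp
    qed
    then have "A x > 0"
      using Apos [OF x0] by blast
    then have Bx: "B x > 0"
      using C(2) [OF x0] C(1) by (smt (verit) mult_nonneg_nonpos)
    show ?thesis
    proof (intro bexI conjI)
      show "(\<lambda>t. (1 / B x) * x t) \<in> finite_tails m"
        by (rule finite_tails_scale [OF x(1)])
      show "B (\<lambda>t. (1 / B x) * x t) = 1"
        using B [OF x0, of "1 / B x"] Bx by simp
      show "\<theta> * \<alpha> \<le> A (\<lambda>t. (1 / B x) * x t)"
        unfolding A [OF x0] using Bx x(2) by (simp add: field_simps)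
    qed
  qed
  obtain n where n: "\<And>x. x \<in> finite_tails n \<Longrightarrow> A x \<le> \<alpha> * B x"
    using \<alpha>(1) by (auto simp: K_def)
  show ?thesis
  proof (rule disjoint_blocks [OF ex, of n])
    fix y :: "nat \<Rightarrow> nat \<Rightarrow> real"
    assume "\<And>k. y k \<in> finite_tails n" "\<And>k. B (y k) = 1 \<and> \<theta> * \<alpha> \<le> A (y k)"
      "\<And>k l t. k \<noteq> l \<Longrightarrow> y k t = 0 \<or> y l t = 0"
    then show ?thesis
      using that [of \<alpha> n y] \<open>\<alpha> > 0\<close> n by simp
  qed
qed

context embedding_of_finite_seqs
begin

lemma T_minus: "x \<in> finite_tails 0 \<Longrightarrow> T (\<lambda>t. - x t) = - T x"
  using T_scale [of x "-1"] by simp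

lemma T_diff:
  assumes "x \<in> finite_tails 0" "y \<in> finite_tails 0"
  shows "T (\<lambda>t. x t - y t) = T x - T y"
  using T_add [OF assms(1) finite_tails_minus [OF assms(2)]] T_minus [OF assms(2)] by simp

lemma T_zero: "T (\<lambda>t. 0) = 0"
  using T_scale [OF finite_tails_zero, of 0] by simp

lemma T_norm_scale: "x \<in> finite_tails 0 \<Longrightarrow> norm (T (\<lambda>t. c * x t)) = \<bar>c\<bar> * norm (T x)"
  by (simp add: T_scale)

lemma T_pos:
  assumes "x \<in> finite_tails 0" "x t \<noteq> 0"
  shows "norm (T x) > 0"
  using N_pos [OF assms] N_le [OF assms(1)] by auto

lemma functional_nonneg_on_cone_of_seqs:
  assumes W: "W \<subseteq> finite_tails 0" "(\<lambda>t. 0) \<in> W"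
    and Wadd: "\<And>x y. x \<in> W \<Longrightarrow> y \<in> W \<Longrightarrow> (\<lambda>t. x t + y t) \<in> W"
    and Wscale: "\<And>c x. c > 0 \<Longrightarrow> x \<in> W \<Longrightarrow> (\<lambda>t. c * x t) \<in> W"
    and v: "v \<in> finite_tails 0"
    and dist: "\<And>x. x \<in> W \<Longrightarrow> d \<le> norm (T (\<lambda>t. v t + x t))"
  obtains f :: "'a \<Rightarrow>\<^sub>L real"
  where "norm f \<le> 1" "d \<le> f (T v)" "\<And>x. x \<in> W \<Longrightarrow> 0 \<le> f (T x)"
proof -
  obtain f :: "'a \<Rightarrow>\<^sub>L real" where "norm f \<le> 1" "d \<le> f (T v)" "\<And>c. c \<in> T ` W \<Longrightarrow> 0 \<le> f c"
  proof (rule functional_nonneg_on_cone [of "T ` W" d "T v"])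
    show "0 \<in> T ` W"
      using W(2) T_zero by (metis imageI)
    show "a + b \<in> T ` W" if ab: "a \<in> T ` W" "b \<in> T ` W" for a b
    proof -
      obtain x y where "x \<in> W" "y \<in> W" "a = T x" "b = T y"
        using ab by blast
      then show ?thesis
        using T_add [OF subsetD [OF W(1)] subsetD [OF W(1)], of x y] by (intro image_eqI [OF _ Wadd [of x y]]) auto
    qed
    show "c *\<^sub>R a \<in> T ` W" if c: "c > 0" "a \<in> T ` W" for c a
    proof -
      obtain x where "x \<in> W" "a = T x"
        using c by blast
      then show ?thesis
        using T_scale [OF subsetD [OF W(1)], of x c] c(1) by (intro image_eqI [OF _ Wscale [of c x]]) auto
    qed
    show "d \<le> norm (T v + a)" if "a \<in> T ` W" for a
      using that dist T_add [OF v] W(1) by fastforce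
  qed blast
  then show ?thesis
    using that by blast
qed

end

section \<open>Antipodal sequences\<close>

text \<open>
  The cone used to separate \<open>T (y i)\<close> from \<open>T (y j)\<close> consists of the \<open>T x\<close> for which \<open>x\<close> has the sign of
  \<open>y j\<close> on the support of \<open>y j\<close> and the opposite sign to \<open>y i\<close> on the support of \<open>y i\<close>. It contains
  both \<open>T (y k)\<close> and its negative for every other \<open>k\<close>, so \<open>f\<close> vanishes there. Adding such an \<open>x\<close> to
  \<open>y j - y i\<close> does not decrease any absolute value on the two supports, so the \<open>p\<close>-th power of
  the \<open>l_p\<close> norm stays at least the sum of those of the two blocks.
\<close>
lemma Ka_set_ell:
  fixes T :: "(nat \<Rightarrow> real) \<Rightarrow> 'a::real_normed_vector"
  assumes p: "p \<ge> 1" and T: "embedding_of_finite_seqs T (ell_norm p) C"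
    and \<theta>: "0 < \<theta>" "\<theta> < 1"
  shows "\<theta> * 2 powr (1 / p) \<in> Ka_set TYPE('a)"
proof -
  interpret embedding_of_finite_seqs T "ell_norm p" C by (rule T)
  obtain \<alpha> n and y :: "nat \<Rightarrow> nat \<Rightarrow> real" where \<alpha>: "\<alpha> > 0" and
    up: "\<And>x. x \<in> finite_tails n \<Longrightarrow> ell_norm p x \<le> \<alpha> * norm (T x)" and
    y: "\<And>k. y k \<in> finite_tails n" "\<And>k. norm (T (y k)) = 1" "\<And>k. \<theta> * \<alpha> \<le> ell_norm p (y k)" and
    disj: "\<And>k l t. k \<noteq> l \<Longrightarrow> y k t = 0 \<or> y l t = 0"
    by (rule almost_proportional_blocks [of "ell_norm p" "\<lambda>x. norm (T x)" C \<theta>])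
       (use N_scale T_norm_scale N_pos C_pos N_le T_le \<theta> in auto)
  note y0 = finite_tails_0 [OF y(1)]
  show ?thesis
  proof (rule Ka_setI [of _ "\<lambda>k. T (y k)"])
    show "\<theta> * 2 powr (1 / p) > 0"
      using \<theta> by simp
    show "norm (T (y k)) \<le> 1" for k
      by (simp add: y(2))
    fix i j :: nat assume "i < j"
    then have "i \<noteq> j" by simp
    define W where "W = {x \<in> finite_tails n. \<forall>t. 0 \<le> x t * y j t \<and> x t * y i t \<le> 0}"
    have low: "\<theta> * 2 powr (1 / p) \<le> norm (T (\<lambda>t. (y j t - y i t) + x t))" if x: "x \<in> W" for x
    proof -
      define z where "z t = (y j t - y i t) + x t" for t
      have zn: "z \<in> finite_tails n"
        using x finite_tails_add [OF finite_tails_add [OF y(1) finite_tails_minus [OF y(1)]], of x j i]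
        by (simp add: W_def z_def [abs_def])
      have pt: "\<bar>y j t\<bar> powr p + \<bar>y i t\<bar> powr p \<le> \<bar>z t\<bar> powr p" for t
      proof -
        have s: "0 \<le> x t * y j t" "x t * y i t \<le> 0"
          using x by (auto simp: W_def)
        consider "y i t = 0" | "y j t = 0"
          using disj [OF \<open>i \<noteq> j\<close>] by blast
        then show ?thesis
        proof cases
          case 1
          then have "\<bar>y j t\<bar> \<le> \<bar>z t\<bar>"
            using s(1) by (auto simp: z_def zero_le_mult_iff)
          then show ?thesis
            using 1 p by (simp add: powr_mono2)
        next
          case 2
          then have "\<bar>y i t\<bar> \<le> \<bar>z t\<bar>"
            using s(2) by (auto simp: z_def mult_le_0_iff)
          then show ?thesis
            using 2 p by (simp add: powr_mono2)
        qed
      qed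
      have sm: "x \<in> finite_tails n \<Longrightarrow> x \<in> ell_space p" for x
        using finite_tails_subset_ell finite_tails_0 by blast
      have sm': "x \<in> finite_tails n \<Longrightarrow> summable (\<lambda>t. \<bar>x t\<bar> powr p)" for x
        using sm by (simp add: ell_space_def)
      have yp: "(\<theta> * \<alpha>) powr p \<le> (\<Sum>t. \<bar>y k t\<bar> powr p)" for k
      proof -
        have "(\<theta> * \<alpha>) powr p \<le> ell_norm p (y k) powr p"
          using p \<theta> \<alpha> y(3) by (intro powr_mono2) auto
        then show ?thesis
          using ell_norm_powr [OF p sm [OF y(1)]] by simp
      qed
      have "2 * (\<theta> * \<alpha>) powr p \<le> (\<Sum>t. \<bar>y j t\<bar> powr p) + (\<Sum>t. \<bar>y i t\<bar> powr p)"
        using yp [of i] yp [of j] by simp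
      also have "\<dots> = (\<Sum>t. \<bar>y j t\<bar> powr p + \<bar>y i t\<bar> powr p)"
        by (intro suminf_add sm' y)
      also have "\<dots> \<le> (\<Sum>t. \<bar>z t\<bar> powr p)"
        by (intro suminf_le pt summable_add sm' y zn)
      finally have "(2 * (\<theta> * \<alpha>) powr p) powr (1 / p) \<le> ell_norm p z"
        unfolding ell_norm_def using p by (intro powr_mono2) auto
      also have "(2 * (\<theta> * \<alpha>) powr p) powr (1 / p) = 2 powr (1 / p) * (\<theta> * \<alpha>)"
        using p \<theta> \<alpha> by (simp add: powr_mult powr_powr)
      also have "ell_norm p z \<le> \<alpha> * norm (T z)"
        by (rule up [OF zn])
      finally have "\<alpha> * (\<theta> * 2 powr (1 / p)) \<le> \<alpha> * norm (T z)"
        by (simp add: algebra_simps)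
      then show ?thesis
        using \<alpha> by (simp add: z_def [abs_def])
    qed
    obtain f :: "'a \<Rightarrow>\<^sub>L real" where f: "norm f \<le> 1"
        "\<theta> * 2 powr (1 / p) \<le> f (T (\<lambda>t. y j t - y i t))" "\<And>x. x \<in> W \<Longrightarrow> 0 \<le> f (T x)"
    proof (rule functional_nonneg_on_cone_of_seqs [of W "\<lambda>t. y j t - y i t" "\<theta> * 2 powr (1 / p)"])
      show "W \<subseteq> finite_tails 0"
        using finite_tails_0 by (auto simp: W_def)
      show "(\<lambda>t. 0) \<in> W"
        by (simp add: W_def finite_tails_zero)
      show "(\<lambda>t. x t + x' t) \<in> W" if "x \<in> W" "x' \<in> W" for x x'
        using that by (auto simp: W_def finite_tails_add distrib_right add_nonpos_nonpos)
      show "(\<lambda>t. c * x t) \<in> W" if "c > 0" "x \<in> W" for c x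
        using that
        by (auto simp: W_def finite_tails_scale mult.assoc intro: mult_nonneg_nonpos)
      show "(\<lambda>t. y j t - y i t) \<in> finite_tails 0"
        using finite_tails_add [OF y0 finite_tails_minus [OF y0], of j i] by simp
    qed (use low in auto)
    have prod0: "y k t * y l t \<le> 0" "0 \<le> y k t * y l t" if "k \<noteq> l" for k l t
      using disj [OF that, of t] by auto
    have "0 \<le> f (T (y j))"
      using prod0 \<open>i \<noteq> j\<close> y(1) by (intro f(3)) (simp add: W_def)
    moreover have "f (T (y i)) \<le> 0"
    proof -
      have "(\<lambda>t. - y i t) \<in> W"
        using prod0 \<open>i \<noteq> j\<close> finite_tails_minus [OF y(1)] by (simp add: W_def)
      then show ?thesis
        using f(3) [of "\<lambda>t. - y i t"] T_minus [OF y0, of i] by (simp add: blinfun.minus_right)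
    qed
    moreover have "f (T (y k)) = 0" if "k \<noteq> i" "k \<noteq> j" for k
    proof -
      have "y k \<in> W" "(\<lambda>t. - y k t) \<in> W"
        using prod0 that y(1) finite_tails_minus [OF y(1)] by (simp_all add: W_def)
      then show ?thesis
        using f(3) [of "y k"] f(3) [of "\<lambda>t. - y k t"] T_minus [OF y0, of k]
        by (simp add: blinfun.minus_right)
    qed
    ultimately have "f (T (y i)) \<le> f (T (y k)) \<and> f (T (y k)) \<le> f (T (y j))" for k
      by (cases "k = i"; cases "k = j") force+
    then show "\<exists>f :: 'a \<Rightarrow>\<^sub>L real. norm f \<le> 1 \<and> \<theta> * 2 powr (1 / p) \<le> blinfun_apply f (T (y j)) - blinfun_apply f (T (y i)) \<and>
        (\<forall>k. blinfun_apply f (T (y i)) \<le> blinfun_apply f (T (y k)) \<and> blinfun_apply f (T (y k)) \<le> blinfun_apply f (T (y j)))"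
      using f(1,2) T_diff [OF y0 y0, of j i] by (auto simp: blinfun.diff_right)
  qed
qed

lemma c0_norm_attained:
  assumes "x \<in> finite_tails 0"
  obtains t where "\<bar>x t\<bar> = c0_norm x"
proof -
  have fin: "finite (insert 0 ((\<lambda>t. \<bar>x t\<bar>) ` {t. x t \<noteq> 0}))"
    using assms by (simp add: finite_tails_def)
  moreover have "range (\<lambda>t. \<bar>x t\<bar>) \<subseteq> insert 0 ((\<lambda>t. \<bar>x t\<bar>) ` {t. x t \<noteq> 0})"
    by auto
  ultimately have "finite (range (\<lambda>t. \<bar>x t\<bar>))"
    by (rule rev_finite_subset)
  then have "c0_norm x \<in> range (\<lambda>t. \<bar>x t\<bar>)"
    unfolding c0_norm_def by (simp add: cSup_eq_Max Max_in)
  then show ?thesis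
    using that by auto
qed

text \<open>
  The coefficients are required blockwise instead of through finite linear combinations, which
  makes closure under sums and multiples immediate.
\<close>
definition block_combinations :: "(nat \<Rightarrow> nat \<Rightarrow> real) \<Rightarrow> (nat \<Rightarrow> real) set"
  where "block_combinations y = {x. (\<forall>t. (\<forall>k. y k t = 0) \<longrightarrow> x t = 0) \<and>
    (\<forall>k. \<exists>a. \<forall>t. y k t \<noteq> 0 \<longrightarrow> x t = a * y k t)}"

lemma block_combinations_add:
  assumes "x \<in> block_combinations y" "z \<in> block_combinations y"
  shows "(\<lambda>t. x t + z t) \<in> block_combinations y"
  unfolding block_combinations_def mem_Collect_eq
proof (intro conjI allI)
  show "(\<forall>k. y k t = 0) \<longrightarrow> x t + z t = 0" for t
    using assms by (simp add: block_combinations_def)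
  fix k
  obtain a b where "\<And>t. y k t \<noteq> 0 \<Longrightarrow> x t = a * y k t" "\<And>t. y k t \<noteq> 0 \<Longrightarrow> z t = b * y k t"
    using assms unfolding block_combinations_def by blast
  then show "\<exists>a. \<forall>t. y k t \<noteq> 0 \<longrightarrow> x t + z t = a * y k t"
    by (intro exI [of _ "a + b"]) (simp add: distrib_right)
qed

lemma block_combinations_scale:
  assumes "x \<in> block_combinations y"
  shows "(\<lambda>t. c * x t) \<in> block_combinations y"
  unfolding block_combinations_def mem_Collect_eq
proof (intro conjI allI)
  show "(\<forall>k. y k t = 0) \<longrightarrow> c * x t = 0" for t
    using assms by (simp add: block_combinations_def)
  fix k
  obtain a where "\<And>t. y k t \<noteq> 0 \<Longrightarrow> x t = a * y k t"
    using assms unfolding block_combinations_def by blast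
  then show "\<exists>a. \<forall>t. y k t \<noteq> 0 \<longrightarrow> c * x t = a * y k t"
    by (intro exI [of _ "c * a"]) simp
qed

text \<open>
  Choose a block on which the supremum norm of \<open>x\<close> is attained, with coefficient \<open>a\<close>. Changing the
  sign of \<open>x\<close> on this block gives a vector \<open>z\<close> of the same supremum norm, so \<open>norm (T z)\<close> is under
  control by the upper estimate, while \<open>x - z\<close> is \<open>2 * a\<close> times the block and so has
  an almost maximal image. The triangle inequality bounds \<open>norm (T x)\<close> from below.
\<close>
lemma c0_block_lower_estimate:
  assumes T: "embedding_of_finite_seqs T c0_norm C"
    and \<alpha>: "\<alpha> > 0" and up: "\<And>x. x \<in> finite_tails n \<Longrightarrow> norm (T x) \<le> \<alpha> * c0_norm x"
    and y: "\<And>k. y k \<in> finite_tails n" "\<And>k. c0_norm (y k) = 1" "\<And>k. \<theta> * \<alpha> \<le> norm (T (y k))"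
    and x: "x \<in> finite_tails n" "x \<in> block_combinations y"
  shows "(2 * \<theta> - 1) * \<alpha> * c0_norm x \<le> norm (T x)"
proof -
  interpret embedding_of_finite_seqs T c0_norm C by (rule T)
  note x0 = finite_tails_0 [OF x(1)] and y0 = finite_tails_0 [OF y(1)]
  have c0: "z \<in> finite_tails 0 \<Longrightarrow> z \<in> c0_space" for z
    using finite_tails_subset_c0 by blast
  obtain t where t: "\<bar>x t\<bar> = c0_norm x"
    using c0_norm_attained [OF x0] .
  show ?thesis
  proof (cases "x t = 0")
    case True
    then show ?thesis
      using t by simp
  next
    case False
    then obtain k a where k: "y k t \<noteq> 0" and a: "\<And>s. y k s \<noteq> 0 \<Longrightarrow> x s = a * y k s"
      using x(2) unfolding block_combinations_def by blast
    have yk: "\<bar>y k s\<bar> \<le> 1" for s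
      using c0_norm_upper [OF c0 [OF y0], of k s] by (simp add: y(2))
    have "c0_norm x \<le> \<bar>a\<bar>"
      using t a [OF k] mult_left_mono [OF yk [of t], of "\<bar>a\<bar>"] by (simp add: abs_mult)
    define z where "z s = x s - (2 * a) * y k s" for s
    have zn: "z \<in> finite_tails n"
      using finite_tails_add [OF x(1) finite_tails_scale [OF y(1) [of k], of "- (2 * a)"]]
      by (simp add: z_def [abs_def])
    have Tz: "T z = T x - (2 * a) *\<^sub>R T (y k)"
      using T_diff [OF x0 finite_tails_scale [OF y0 [of k]], of "2 * a"] T_scale [OF y0 [of k]]
      by (simp add: z_def [abs_def])
    have "\<bar>z s\<bar> = \<bar>x s\<bar>" for s
      using a [of s] by (cases "y k s = 0") (auto simp: z_def)
    then have Nz: "c0_norm z = c0_norm x"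
      by (simp add: c0_norm_def)
    have "2 * c0_norm x * (\<theta> * \<alpha>) \<le> 2 * c0_norm x * norm (T (y k))"
      using y(3) [of k] t by (intro mult_left_mono) auto
    also have "\<dots> \<le> 2 * \<bar>a\<bar> * norm (T (y k))"
      using \<open>c0_norm x \<le> \<bar>a\<bar>\<close> by (intro mult_right_mono) auto
    also have "\<dots> = norm (T x - T z)"
      by (simp add: Tz abs_mult)
    also have "\<dots> \<le> norm (T x) + norm (T z)"
      by (rule norm_triangle_ineq4)
    also have "\<dots> \<le> norm (T x) + \<alpha> * c0_norm x"
      using up [OF zn] by (simp add: Nz)
    finally show ?thesis
      by (simp add: algebra_simps)
  qed
qed

text \<open>
  For \<open>i < j\<close> the separating functional imitates the coefficient at the block \<open>y (Suc i)\<close>, the one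
  that enters the \<open>i\<close>-th vector with the coefficient \<open>-1\<close>: the cone consists of the block
  combinations whose coefficient there is nonnegative, which makes \<open>f\<close> monotone in this
  coefficient along the sequence.
\<close>
lemma Ka_set_c0:
  fixes T :: "(nat \<Rightarrow> real) \<Rightarrow> 'a::real_normed_vector"
  assumes T: "embedding_of_finite_seqs T c0_norm C" and \<eta>: "0 < \<eta>" "\<eta> < 1"
  shows "\<eta> * 2 \<in> Ka_set TYPE('a)"
proof -
  interpret embedding_of_finite_seqs T c0_norm C by (rule T)
  \<comment> \<open>With this \<open>\<theta>\<close> the factor \<open>2 * \<theta> - 1\<close> of the lower estimate for block combinations is \<open>\<eta>\<close>.\<close>
  define \<theta> where "\<theta> = (1 + \<eta>) / 2"
  have \<theta>: "0 < \<theta>" "\<theta> < 1" "2 * \<theta> - 1 = \<eta>"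
    using \<eta> by (auto simp: \<theta>_def field_simps)
  obtain \<alpha> n and y :: "nat \<Rightarrow> nat \<Rightarrow> real" where \<alpha>: "\<alpha> > 0" and
    up: "\<And>x. x \<in> finite_tails n \<Longrightarrow> norm (T x) \<le> \<alpha> * c0_norm x" and
    y: "\<And>k. y k \<in> finite_tails n" "\<And>k. c0_norm (y k) = 1" "\<And>k. \<theta> * \<alpha> \<le> norm (T (y k))" and
    disj: "\<And>k l t. k \<noteq> l \<Longrightarrow> y k t = 0 \<or> y l t = 0"
    by (rule almost_proportional_blocks [of "\<lambda>x. norm (T x)" c0_norm C \<theta>])
       (use N_scale T_norm_scale T_pos C_pos N_le T_le \<theta> in auto)
  note y0 = finite_tails_0 [OF y(1)]
  have c0: "z \<in> finite_tails n \<Longrightarrow> z \<in> c0_space" for z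
    using finite_tails_subset_c0 finite_tails_0 by blast
  define x where "x k t = (\<Sum>l\<le>k. y l t) - y (Suc k) t" for k t
  \<comment> \<open>\<open>\<sigma> k l\<close> is the coefficient of \<open>x k\<close> at the block \<open>y l\<close>.\<close>
  define \<sigma> :: "nat \<Rightarrow> nat \<Rightarrow> real"
    where "\<sigma> k l = (if l \<le> k then 1 else if l = Suc k then -1 else 0)" for k l
  have \<sigma>: "x k t = \<sigma> k l * y l t" if "y l t \<noteq> 0" for k l t
  proof -
    have z: "y l' t = 0" if "l' \<noteq> l" for l'
      using disj [OF that] \<open>y l t \<noteq> 0\<close> by blast
    have "(\<Sum>l'\<le>k. y l' t) = (\<Sum>l'\<le>k. if l' = l then y l t else 0)"
      using z by (intro sum.cong) auto
    then have "(\<Sum>l'\<le>k. y l' t) = (if l \<le> k then y l t else 0)"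
      by simp
    then show ?thesis
      using z by (auto simp: x_def \<sigma>_def)
  qed
  have xn: "x k \<in> finite_tails n" for k
    using finite_tails_add [OF finite_tails_sum finite_tails_minus, of "{..k}" y n "y (Suc k)"] y(1)
    by (simp add: x_def [abs_def])
  note x0 = finite_tails_0 [OF xn]
  have x_blocks: "\<exists>l. y l t \<noteq> 0" if "x k t \<noteq> 0" for k t
    using that unfolding x_def by (metis diff_self sum.neutral)
  have xb: "x k \<in> block_combinations y" for k
    unfolding block_combinations_def using \<sigma> x_blocks by blast
  have "c0_norm (x k) \<le> 1" for k
  proof (rule c0_norm_le)
    fix t
    show "\<bar>x k t\<bar> \<le> 1"
    proof (cases "x k t = 0")
      case False
      then obtain l where l: "y l t \<noteq> 0"
        using x_blocks by blast
      have "\<bar>x k t\<bar> \<le> \<bar>y l t\<bar>"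
        using \<sigma> [OF l, of k] by (simp add: \<sigma>_def)
      then show ?thesis
        using c0_norm_upper [OF c0 [OF y(1)], of l t] by (simp add: y(2))
    qed simp
  qed
  then have "\<alpha> * c0_norm (x k) \<le> \<alpha> * 1" for k
    using \<alpha> by (intro mult_left_mono) auto
  then have x1: "norm (T (x k)) \<le> \<alpha>" for k
    using order_trans [OF up [OF xn]] by simp
  show ?thesis
  proof (rule Ka_setI [of _ "\<lambda>k. (1 / \<alpha>) *\<^sub>R T (x k)"])
    show "\<eta> * 2 > 0"
      using \<eta> by simp
    show "norm ((1 / \<alpha>) *\<^sub>R T (x k)) \<le> 1" for k
      using x1 [of k] \<alpha> by simp
    fix i j :: nat assume "i < j"
    define W where "W = {x \<in> finite_tails n \<inter> block_combinations y. \<forall>t. 0 \<le> x t * y (Suc i) t}"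
    have diffs: "(\<lambda>t. x k t - x l t) \<in> finite_tails n \<inter> block_combinations y" for k l
      using finite_tails_add [OF xn finite_tails_scale [OF xn, of "-1"], of k l]
        block_combinations_add [OF xb block_combinations_scale [OF xb, of "-1"], of k l]
      by simp
    have W_diff: "(\<lambda>t. x k t - x l t) \<in> W" if "\<sigma> l (Suc i) \<le> \<sigma> k (Suc i)" for k l
    proof -
      have "0 \<le> (x k t - x l t) * y (Suc i) t" for t
      proof (cases "y (Suc i) t = 0")
        case False
        have "(x k t - x l t) * y (Suc i) t = (\<sigma> k (Suc i) - \<sigma> l (Suc i)) * (y (Suc i) t)\<^sup>2"
          unfolding \<sigma> [OF False] by (simp add: power2_eq_square algebra_simps)
        then show ?thesis
          using that by simp
      qed simp
      then show ?thesis
        using diffs by (simp add: W_def)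
    qed
    have low: "2 * \<eta> * \<alpha> \<le> norm (T (\<lambda>t. (x j t - x i t) + w t))" if w: "w \<in> W" for w
    proof -
      define z where "z t = (x j t - x i t) + w t" for t
      have z: "z \<in> finite_tails n" "z \<in> block_combinations y"
        using w diffs [of j i] finite_tails_add block_combinations_add
        by (auto simp: W_def z_def [abs_def])
      obtain t where t: "\<bar>y (Suc i) t\<bar> = 1"
        using c0_norm_attained [OF y0] y(2) by metis
      then have nz: "y (Suc i) t \<noteq> 0" by auto
      have "z t = 2 * y (Suc i) t + w t"
        using \<sigma> [OF nz, of i] \<sigma> [OF nz, of j] \<open>i < j\<close> by (simp add: z_def \<sigma>_def)
      moreover have "0 \<le> w t * y (Suc i) t"
        using w by (simp add: W_def)
      ultimately have "2 \<le> \<bar>z t\<bar>"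
        using t by (auto simp: zero_le_mult_iff)
      then have "2 \<le> c0_norm z"
        using c0_norm_upper [OF c0 [OF z(1)], of t] by linarith
      then have "2 * \<eta> * \<alpha> \<le> \<eta> * \<alpha> * c0_norm z"
        using \<eta> \<alpha> by simp
      also have "\<dots> \<le> norm (T z)"
        using c0_block_lower_estimate [OF T \<alpha> up y z] by (simp add: \<theta>(3))
      finally show ?thesis
        by (simp add: z_def [abs_def])
    qed
    obtain f :: "'a \<Rightarrow>\<^sub>L real" where f: "norm f \<le> 1"
        "2 * \<eta> * \<alpha> \<le> f (T (\<lambda>t. x j t - x i t))" "\<And>x. x \<in> W \<Longrightarrow> 0 \<le> f (T x)"
    proof (rule functional_nonneg_on_cone_of_seqs [of W "\<lambda>t. x j t - x i t" "2 * \<eta> * \<alpha>"])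
      show "W \<subseteq> finite_tails 0"
        using finite_tails_0 by (auto simp: W_def)
      show "(\<lambda>t. 0) \<in> W"
        using W_diff [of i i] by simp
      show "(\<lambda>t. x t + x' t) \<in> W" if "x \<in> W" "x' \<in> W" for x x'
        using that by (auto simp: W_def finite_tails_add block_combinations_add distrib_right)
      show "(\<lambda>t. c * x t) \<in> W" if "c > 0" "x \<in> W" for c x
        using that by (auto simp: W_def finite_tails_scale block_combinations_scale mult.assoc)
      show "(\<lambda>t. x j t - x i t) \<in> finite_tails 0"
        using diffs finite_tails_0 by blast
    qed (use low in auto)
    have mono: "f (T (x l)) \<le> f (T (x k))" if "\<sigma> l (Suc i) \<le> \<sigma> k (Suc i)" for k l
      using f(3) [OF W_diff [OF that]] T_diff [OF x0 x0, of k l] by (simp add: blinfun.diff_right)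
    have "f (T (x i)) \<le> f (T (x k)) \<and> f (T (x k)) \<le> f (T (x j))" for k
      using \<open>i < j\<close> by (intro conjI mono) (auto simp: \<sigma>_def)
    moreover have "\<eta> * 2 \<le> (f (T (x j)) - f (T (x i))) / \<alpha>"
      using f(2) \<alpha> T_diff [OF x0 x0, of j i] by (simp add: blinfun.diff_right field_simps)
    ultimately show "\<exists>f :: 'a \<Rightarrow>\<^sub>L real. norm f \<le> 1 \<and>
        \<eta> * 2 \<le> blinfun_apply f ((1 / \<alpha>) *\<^sub>R T (x j)) - blinfun_apply f ((1 / \<alpha>) *\<^sub>R T (x i)) \<and>
        (\<forall>k. blinfun_apply f ((1 / \<alpha>) *\<^sub>R T (x i)) \<le> blinfun_apply f ((1 / \<alpha>) *\<^sub>R T (x k)) \<and>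
             blinfun_apply f ((1 / \<alpha>) *\<^sub>R T (x k)) \<le> blinfun_apply f ((1 / \<alpha>) *\<^sub>R T (x j)))"
      using f(1) \<alpha> by (intro exI [of _ f]) (simp add: blinfun.scaleR_right divide_right_mono diff_divide_distrib)
  qed
qed

lemma Ka_geI:
  assumes mem: "\<And>\<theta>. 0 < \<theta> \<Longrightarrow> \<theta> < 1 \<Longrightarrow> \<theta> * D \<in> Ka_set TYPE('a::real_normed_vector)"
  shows "D \<le> Ka TYPE('a)"
proof (rule field_le_mult_one_interval)
  fix \<theta> :: real assume "0 < \<theta>" "\<theta> < 1"
  then show "\<theta> * D \<le> Ka TYPE('a)"
    unfolding Ka_def by (intro cSup_upper mem bdd_above_Ka_set)
qed

lemma Ka_eq_2I:
  assumes "2 \<le> Ka TYPE('a::real_normed_vector)" "Ka_set TYPE('a) \<noteq> {}"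
  shows "Ka TYPE('a) = 2"
  using assms cSup_least [OF assms(2) Ka_set_le_2] by (simp add: Ka_def)

lemma ell_copy_embedding:
  assumes p: "p \<ge> 1" and "contains_isomorphic_copy TYPE('a::real_normed_vector) (ell_space p) (ell_norm p)"
  obtains T :: "(nat \<Rightarrow> real) \<Rightarrow> 'a::real_normed_vector" and C where "embedding_of_finite_seqs T (ell_norm p) C"
proof (rule isomorphic_copy_embedding [OF assms(2) Metric_space_ell [OF p] finite_tails_subset_ell])
  show "(\<lambda>n. c * x n) \<in> ell_space p" if "x \<in> ell_space p" for c x
    using that by (simp add: ell_space_def abs_mult powr_mult summable_mult)
qed (use ell_norm_scale [OF p] in auto)

lemma c0_copy_embedding:
  assumes "contains_isomorphic_copy TYPE('a::real_normed_vector) c0_space c0_norm"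
  obtains T :: "(nat \<Rightarrow> real) \<Rightarrow> 'a::real_normed_vector" and C where "embedding_of_finite_seqs T c0_norm C"
proof (rule isomorphic_copy_embedding [OF assms Metric_space_c0 finite_tails_subset_c0])
  show "(\<lambda>n. c * x n) \<in> c0_space" if "x \<in> c0_space" for c x
    using that by (simp add: c0_space_def tendsto_mult_right_zero)
qed (use c0_norm_scale in auto)

theorem proposition1p2:
  assumes "infinite_dimensional TYPE('a::banach)"
  shows "(contains_isomorphic_copy TYPE('a) c0_space c0_norm \<or>
          contains_isomorphic_copy TYPE('a) (ell_space 1) (ell_norm 1) \<longrightarrow> Ka TYPE('a) = 2) \<and>
         (\<forall>p>1. contains_isomorphic_copy TYPE('a) (ell_space p) (ell_norm p) \<longrightarrow>
                  Ka TYPE('a) \<ge> 2 powr (1 / p))"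
proof (intro conjI impI allI)
  have ell: "\<theta> * 2 powr (1 / p) \<in> Ka_set TYPE('a)"
    if "p \<ge> 1" "contains_isomorphic_copy TYPE('a) (ell_space p) (ell_norm p)" "0 < \<theta>" "\<theta> < 1"
    for p \<theta> :: real
    using that ell_copy_embedding Ka_set_ell by metis
  show "Ka TYPE('a) \<ge> 2 powr (1 / p)"
    if "p > 1" "contains_isomorphic_copy TYPE('a) (ell_space p) (ell_norm p)" for p :: real
    using that ell [of p] by (intro Ka_geI) auto
  assume "contains_isomorphic_copy TYPE('a) c0_space c0_norm \<or>
          contains_isomorphic_copy TYPE('a) (ell_space 1) (ell_norm 1)"
  then have "\<theta> * 2 \<in> Ka_set TYPE('a)" if "0 < \<theta>" "\<theta> < 1" for \<theta>
    using ell [of 1 \<theta>] c0_copy_embedding Ka_set_c0 that by (metis div_by_1 order_refl powr_one zero_le_numeral)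
  then show "Ka TYPE('a) = 2"
    using dense [of 0 "1 :: real"] by (intro Ka_eq_2I Ka_geI) auto
qed

end
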